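(* Let $A\in\mathbb{N}^{m\times n}$. If $\operatorname{rank}(A)=m$, then the tensor product Chebyshev variety $\mathcal{X}_{A,\otimes}\subset\mathbb{C}^n$ has dimension $m$.
   Context: The Chebyshev polynomials of the first kind are defined by $T_0(t)=1$, $T_1(t)=t$, $T_{k+1}(t)=2t\,T_k(t)-T_{k-1}(t)$. Let $A=[a_1~\cdots~a_n]\in\mathbb{N}^{m\times n}$ have columns $a_j=(a_{1j},\ldots,a_{mj})$. For each $j$ put $\mathcal{T}_{a_j,\otimes}(t_1,\ldots,t_m)=T_{a_{1j}}(t_1)\,T_{a_{2j}}(t_2)\cdots T_{a_{mj}}(t_m)$. The tensor product Chebyshev variety $\mathcal{X}_{A,\otimes}\subset\mathbb{C}^n$ is the Zariski closure of the image of the map $\mathbb{C}^m\to\mathbb{C}^n$, $t\mapsto(\mathcal{T}_{a_1,\otimes}(t),\ldots,\mathcal{T}_{a_n,\otimes}(t))$. *)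

theory Defs
  imports
    "HOL-Analysis.Analysis"
    "HOL-Computational_Algebra.Polynomial"
    "HOL-Library.Poly_Mapping"
begin

section \<open>Polynomials in several variables\<close>

text \<open>
  A polynomial over \<open>'a\<close> in variables indexed by \<open>'n\<close> is a finitely supported map
  from exponent vectors to coefficients; addition and multiplication are those of
  \<^theory>\<open>HOL-Library.Poly_Mapping\<close>.
\<close>

type_synonym ('n, 'a) mpoly = "('n \<Rightarrow>\<^sub>0 nat) \<Rightarrow>\<^sub>0 'a"

definition monom_eval :: "('n::finite \<Rightarrow>\<^sub>0 nat) \<Rightarrow> 'a::comm_ring_1 ^ 'n \<Rightarrow> 'a" where
  "monom_eval e x = (\<Prod>i\<in>UNIV. (x $ i) ^ Poly_Mapping.lookup e i)"

definition mpoly_eval :: "('n::finite, 'a::comm_ring_1) mpoly \<Rightarrow> 'a ^ 'n \<Rightarrow> 'a" where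
  "mpoly_eval p x = (\<Sum>e\<in>Poly_Mapping.keys p. Poly_Mapping.lookup p e * monom_eval e x)"

lemma monom_eval_zero [simp]: "monom_eval 0 x = 1"
  by (simp add: monom_eval_def)

lemma monom_eval_add: "monom_eval (d + e) x = monom_eval d x * monom_eval e x"
  by (simp add: monom_eval_def Poly_Mapping.lookup_add power_add prod.distrib)

lemma mpoly_eval_superset:
  assumes "finite K" "Poly_Mapping.keys p \<subseteq> K"
  shows "mpoly_eval p x = (\<Sum>e\<in>K. Poly_Mapping.lookup p e * monom_eval e x)"
  unfolding mpoly_eval_def
  by (rule sum.mono_neutral_left) (use assms in \<open>auto simp: Poly_Mapping.in_keys_iff\<close>)

lemma mpoly_eval_zero [simp]: "mpoly_eval 0 x = 0"
  by (simp add: mpoly_eval_def)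

lemma mpoly_eval_single [simp]:
  "mpoly_eval (Poly_Mapping.single e c) x = c * monom_eval e x"
  by (subst mpoly_eval_superset[of "{e}"]) (auto simp: Poly_Mapping.lookup_single)

lemma mpoly_eval_one [simp]: "mpoly_eval 1 x = 1"
  by (simp flip: Poly_Mapping.single_one)

lemma mpoly_eval_add: "mpoly_eval (p + q) x = mpoly_eval p x + mpoly_eval q x"
proof -
  let ?K = "Poly_Mapping.keys p \<union> Poly_Mapping.keys q"
  have "Poly_Mapping.keys (p + q) \<subseteq> ?K"
    by (rule Poly_Mapping.keys_add)
  then show ?thesis
    by (simp add: mpoly_eval_superset[of ?K] Poly_Mapping.lookup_add distrib_right sum.distrib)
qed

lemma mpoly_eval_sum: "mpoly_eval (sum f I) x = (\<Sum>i\<in>I. mpoly_eval (f i) x)"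
  by (induction I rule: infinite_finite_induct) (simp_all add: mpoly_eval_add)

lemma mpoly_expansion:
  fixes p :: "'b \<Rightarrow>\<^sub>0 'a::comm_monoid_add"
  shows "p = (\<Sum>e\<in>Poly_Mapping.keys p. Poly_Mapping.single e (Poly_Mapping.lookup p e))"
  by (rule poly_mapping_eqI)
    (auto simp: Poly_Mapping.lookup_sum Poly_Mapping.lookup_single when_def
      Poly_Mapping.in_keys_iff)

lemma mpoly_eval_mult: "mpoly_eval (p * q) x = mpoly_eval p x * mpoly_eval q x"
proof -
  have "p * q = (\<Sum>d\<in>Poly_Mapping.keys p. \<Sum>e\<in>Poly_Mapping.keys q.
      Poly_Mapping.single (d + e) (Poly_Mapping.lookup p d * Poly_Mapping.lookup q e))"
    using arg_cong2[where f = "(*)", OF mpoly_expansion[of p] mpoly_expansion[of q]]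
    unfolding sum_product Poly_Mapping.mult_single .
  then have "mpoly_eval (p * q) x = (\<Sum>d\<in>Poly_Mapping.keys p. \<Sum>e\<in>Poly_Mapping.keys q.
      (Poly_Mapping.lookup p d * monom_eval d x) * (Poly_Mapping.lookup q e * monom_eval e x))"
    by (simp add: mpoly_eval_sum monom_eval_add mult_ac)
  then show ?thesis
    by (simp add: mpoly_eval_def sum_product)
qed


section \<open>The Zariski topology on affine space\<close>

definition zero_locus :: "('n::finite, 'a::comm_ring_1) mpoly set \<Rightarrow> ('a ^ 'n) set" where
  "zero_locus P = {x. \<forall>p\<in>P. mpoly_eval p x = 0}"

definition zariski_topology :: "('a::idom ^ 'n::finite) topology" where
  "zariski_topology = topology (\<lambda>U. \<exists>P. U = - zero_locus P)"

lemma zero_locus_Un: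
  fixes P Q :: "('n::finite, 'a::idom) mpoly set"
  shows "zero_locus P \<union> zero_locus Q = zero_locus {p * q | p q. p \<in> P \<and> q \<in> Q}"
proof (intro equalityI subsetI)
  fix x assume "x \<in> zero_locus P \<union> zero_locus Q"
  then show "x \<in> zero_locus {p * q | p q. p \<in> P \<and> q \<in> Q}"
    by (auto simp: zero_locus_def mpoly_eval_mult)
next
  fix x assume x: "x \<in> zero_locus {p * q | p q. p \<in> P \<and> q \<in> Q}"
  have "mpoly_eval p x = 0 \<or> mpoly_eval q x = 0" if "p \<in> P" "q \<in> Q" for p q
  proof -
    have "mpoly_eval (p * q) x = 0"
      using x that unfolding zero_locus_def by blast
    then show ?thesis
      by (simp add: mpoly_eval_mult)
  qed
  then show "x \<in> zero_locus P \<union> zero_locus Q"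
    unfolding zero_locus_def by blast
qed

lemma zero_locus_INT: "(\<Inter>i\<in>I. zero_locus (P i)) = zero_locus (\<Union>i\<in>I. P i)"
  by (auto simp: zero_locus_def)

lemma istopology_zariski: "istopology (\<lambda>U :: ('a::idom ^ 'n::finite) set. \<exists>P. U = - zero_locus P)"
  unfolding istopology_def
proof (intro conjI allI impI)
  fix S T :: "('a ^ 'n) set"
  assume "\<exists>P. S = - zero_locus P" "\<exists>P. T = - zero_locus P"
  then obtain P Q where "S = - zero_locus P" "T = - zero_locus Q"
    by blast
  then have "S \<inter> T = - (zero_locus P \<union> zero_locus Q)"
    by simp
  then show "\<exists>P. S \<inter> T = - zero_locus P"
    unfolding zero_locus_Un by blast
next
  fix \<U> :: "('a ^ 'n) set set"
  assume "\<forall>U\<in>\<U>. \<exists>P. U = - zero_locus P"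
  then obtain P where "\<And>U. U \<in> \<U> \<Longrightarrow> U = - zero_locus (P U)"
    by metis
  then have "\<Union>\<U> = - (\<Inter>U\<in>\<U>. zero_locus (P U))"
    by auto
  then show "\<exists>P. \<Union>\<U> = - zero_locus P"
    unfolding zero_locus_INT by blast
qed

lemma openin_zariski: "openin zariski_topology U \<longleftrightarrow> (\<exists>P. U = - zero_locus P)"
  unfolding zariski_topology_def by (simp add: topology_inverse'[OF istopology_zariski])

lemma topspace_zariski [simp]: "topspace zariski_topology = UNIV"
proof -
  have "UNIV = - zero_locus {1}"
    by (auto simp: zero_locus_def)
  then have "openin zariski_topology UNIV"
    unfolding openin_zariski by blast
  then show ?thesis
    using openin_subset by blast
qed

lemma closedin_zariski: "closedin zariski_topology Z \<longleftrightarrow> (\<exists>P. Z = zero_locus P)"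
proof -
  have "closedin zariski_topology Z \<longleftrightarrow> (\<exists>P. UNIV - Z = - zero_locus P)"
    by (simp only: closedin_def openin_zariski topspace_zariski subset_UNIV simp_thms)
  also have "\<dots> \<longleftrightarrow> (\<exists>P. Z = zero_locus P)"
    by (simp only: Compl_eq_Diff_UNIV[symmetric] Compl_eq_Compl_iff)
  finally show ?thesis .
qed


section \<open>Krull dimension\<close>

definition irreducible_in :: "'a topology \<Rightarrow> 'a set \<Rightarrow> bool" where
  "irreducible_in X Z \<longleftrightarrow> Z \<subseteq> topspace X \<and> Z \<noteq> {} \<and>
     (\<forall>C D. closedin X C \<and> closedin X D \<and> Z \<subseteq> C \<union> D \<longrightarrow> Z \<subseteq> C \<or> Z \<subseteq> D)"

text \<open>
  The supremum of the lengths \<open>k\<close> of chains \<open>Z 0 \<subset> \<dots> \<subset> Z k\<close> of irreducible closed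
  subsets. The value is an extended real, so that it is \<open>- \<infinity>\<close> for the empty space
  (supremum of the empty set) and \<open>\<infinity>\<close> if the lengths are unbounded.
\<close>

definition krull_dimension :: "'a topology \<Rightarrow> ereal" where
  "krull_dimension X = Sup {ereal (real k) | k. \<exists>Z :: nat \<Rightarrow> 'a set.
     (\<forall>i\<le>k. closedin X (Z i) \<and> irreducible_in X (Z i)) \<and> (\<forall>i<k. Z i \<subset> Z (Suc i))}"

definition zariski_dimension :: "('a::idom ^ 'n::finite) set \<Rightarrow> ereal" where
  "zariski_dimension V = krull_dimension (subtopology zariski_topology V)"


section \<open>Tensor product Chebyshev varieties\<close>

fun chebyshev_T :: "nat \<Rightarrow> 'a::comm_ring_1 poly" where
  "chebyshev_T 0 = 1"
| "chebyshev_T (Suc 0) = [:0, 1:]"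
| "chebyshev_T (Suc (Suc k)) = 2 * [:0, 1:] * chebyshev_T (Suc k) - chebyshev_T k"

definition tensor_chebyshev :: "nat ^ 'm \<Rightarrow> complex ^ 'm \<Rightarrow> complex" where
  "tensor_chebyshev a t = (\<Prod>i\<in>UNIV. poly (chebyshev_T (a $ i)) (t $ i))"

definition tensor_chebyshev_map :: "nat ^ 'n ^ 'm \<Rightarrow> complex ^ 'm \<Rightarrow> complex ^ 'n" where
  "tensor_chebyshev_map A t = (\<chi> j. tensor_chebyshev (column j A) t)"

definition tensor_chebyshev_variety :: "nat ^ 'n ^ 'm \<Rightarrow> (complex ^ 'n) set" where
  "tensor_chebyshev_variety A = zariski_topology closure_of (range (tensor_chebyshev_map A))"

end

theory Submission
  imports Defs
begin

text \<open>
  Both bounds on the dimension come from comparing chains of irreducible closed sets with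
  algebraic independence of polynomial functions on a set. Two facts link them.

  First, independence grows along chains: if \<open>Z\<close> is a proper closed subset of an irreducible
  set \<open>W\<close>, a polynomial vanishing on \<open>Z\<close> but not on \<open>W\<close> can be added to any functions that are
  independent on \<open>Z\<close>, and the result is independent on \<open>W\<close> (\<open>alg_independent_on_insert\<close>).
  Hence the end of a chain of length \<open>k\<close> carries \<open>k\<close> independent polynomials
  (\<open>chain_alg_independent\<close>). Second, more than \<open>d\<close> polynomials in \<open>d\<close> variables are dependent,
  by counting monomials (\<open>not_alg_independent_if_card_less\<close>). Polynomials that are independent
  on the variety remain independent when pulled back along its parametrization by \<open>m\<close>
  variables, so no chain in the variety is longer than \<open>m\<close>.

  For a chain of length \<open>m\<close>, let \<open>W I\<close> be the closure of the image of the linear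
  subspace on which the variables outside \<open>I\<close> equal \<open>1\<close>. It is irreducible, being the closure of
  a polynomial image of an affine space. As Chebyshev polynomials take the value \<open>1\<close> at \<open>1\<close>, the
  map restricted to this subspace is the tensor product Chebyshev map of the rows of \<open>A\<close> in \<open>I\<close>.
  These rows are linearly independent, so some \<open>card I\<close> columns are independent after
  restriction to these rows, and a leading term argument makes the corresponding coordinates
  algebraically independent on \<open>W I\<close> (\<open>alg_independent_tensor_chebyshev\<close>). On \<open>W I'\<close> with
  \<open>card I' < card I\<close> they are dependent, by the second fact. So \<open>W I\<close> grows strictly as \<open>I\<close> runs
  through an increasing chain of sets of sizes \<open>0, \<dots>, m\<close>.
\<close>


section \<open>Polynomial functions in a subset of the variables\<close>

definition polynomial_in :: "'n set \<Rightarrow> ('a::comm_ring_1 ^ 'n::finite \<Rightarrow> 'a) \<Rightarrow> bool" where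
  "polynomial_in I f \<longleftrightarrow>
     (\<exists>p. (\<forall>e\<in>Poly_Mapping.keys p. Poly_Mapping.keys e \<subseteq> I) \<and> f = mpoly_eval p)"

lemma polynomial_in_UNIV: "polynomial_in UNIV f \<longleftrightarrow> (\<exists>p. f = mpoly_eval p)"
  by (simp add: polynomial_in_def)

lemma polynomial_in_const [simp]: "polynomial_in I (\<lambda>x. c)"
  unfolding polynomial_in_def
  by (rule exI[of _ "Poly_Mapping.single 0 c"]) (auto simp: fun_eq_iff)

lemma polynomial_in_coord:
  fixes i :: "'n::finite"
  assumes "i \<in> I"
  shows "polynomial_in I (\<lambda>x :: 'a::comm_ring_1 ^ 'n. x $ i)"
proof -
  have "monom_eval (Poly_Mapping.single i 1) x = x $ i" for x :: "'a ^ 'n"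
  proof -
    have "monom_eval (Poly_Mapping.single i 1) x = (\<Prod>k\<in>UNIV. if k = i then x $ k else 1)"
      unfolding monom_eval_def
      by (rule prod.cong) (auto simp: Poly_Mapping.lookup_single when_def)
    then show ?thesis
      by simp
  qed
  then show ?thesis
    unfolding polynomial_in_def using assms
    by (intro exI[of _ "Poly_Mapping.single (Poly_Mapping.single i 1) 1"]) (auto simp: fun_eq_iff)
qed

lemma polynomial_in_add:
  assumes "polynomial_in I f" "polynomial_in I g"
  shows "polynomial_in I (\<lambda>x. f x + g x)"
proof -
  obtain p q where pq: "\<forall>e\<in>Poly_Mapping.keys p. Poly_Mapping.keys e \<subseteq> I" "f = mpoly_eval p"
    "\<forall>e\<in>Poly_Mapping.keys q. Poly_Mapping.keys e \<subseteq> I" "g = mpoly_eval q"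
    using assms unfolding polynomial_in_def by blast
  have "Poly_Mapping.keys e \<subseteq> I" if "e \<in> Poly_Mapping.keys (p + q)" for e
    using that pq(1,3) Poly_Mapping.keys_add[of p q] by blast
  then show ?thesis
    unfolding polynomial_in_def using pq
    by (intro exI[of _ "p + q"]) (simp add: fun_eq_iff mpoly_eval_add)
qed

lemma polynomial_in_mult:
  assumes "polynomial_in I f" "polynomial_in I g"
  shows "polynomial_in I (\<lambda>x. f x * g x)"
proof -
  obtain p q where pq: "\<forall>e\<in>Poly_Mapping.keys p. Poly_Mapping.keys e \<subseteq> I" "f = mpoly_eval p"
    "\<forall>e\<in>Poly_Mapping.keys q. Poly_Mapping.keys e \<subseteq> I" "g = mpoly_eval q"
    using assms unfolding polynomial_in_def by blast
  have "Poly_Mapping.keys e \<subseteq> I" if e: "e \<in> Poly_Mapping.keys (p * q)" for e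
  proof -
    obtain a b where "e = a + b" "a \<in> Poly_Mapping.keys p" "b \<in> Poly_Mapping.keys q"
      using Poly_Mapping.keys_mult[of p q] e by blast
    then show ?thesis
      using pq Poly_Mapping.keys_add[of a b] by blast
  qed
  then show ?thesis
    unfolding polynomial_in_def using pq
    by (intro exI[of _ "p * q"]) (simp add: fun_eq_iff mpoly_eval_mult)
qed

lemma polynomial_in_sum:
  assumes "\<And>s. s \<in> S \<Longrightarrow> polynomial_in I (f s)"
  shows "polynomial_in I (\<lambda>x. \<Sum>s\<in>S. f s x)"
  using assms by (induction S rule: infinite_finite_induct) (auto intro: polynomial_in_add)

lemma polynomial_in_prod:
  assumes "\<And>s. s \<in> S \<Longrightarrow> polynomial_in I (f s)"
  shows "polynomial_in I (\<lambda>x. \<Prod>s\<in>S. f s x)"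
  using assms by (induction S rule: infinite_finite_induct) (auto intro: polynomial_in_mult)

lemma polynomial_in_power:
  "polynomial_in I f \<Longrightarrow> polynomial_in I (\<lambda>x. f x ^ k)"
  by (induction k) (auto intro: polynomial_in_mult)

lemma polynomial_in_compose_poly:
  assumes "polynomial_in I f"
  shows "polynomial_in I (\<lambda>x. poly r (f x))"
  by (induction r) (simp_all add: polynomial_in_add polynomial_in_mult assms)

lemma polynomial_in_compose:
  assumes "polynomial_in UNIV f" "\<And>j. polynomial_in I (\<lambda>t. h t $ j)"
  shows "polynomial_in I (\<lambda>t. f (h t))"
proof -
  obtain p where "f = mpoly_eval p"
    using assms(1) unfolding polynomial_in_UNIV by blast
  then show ?thesis
    unfolding mpoly_eval_def monom_eval_def
    by (auto intro!: polynomial_in_sum polynomial_in_mult polynomial_in_prod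
        polynomial_in_power assms(2))
qed

text \<open>
  Polynomial functions over a field of characteristic 0 form an integral domain: a line through a point
  where \<open>f\<close> does not vanish and a point where \<open>g\<close> does not vanish reduces this to polynomials in
  one variable.
\<close>

lemma polynomial_in_mult_eq_0:
  fixes f g :: "'a::field_char_0 ^ 'n::finite \<Rightarrow> 'a"
  assumes "polynomial_in UNIV f" "polynomial_in UNIV g" "\<And>x. f x * g x = 0"
  shows "(\<forall>x. f x = 0) \<or> (\<forall>x. g x = 0)"
proof (rule ccontr)
  assume "\<not> ?thesis"
  then obtain u v where uv: "f u \<noteq> 0" "g v \<noteq> 0"
    by blast
  define line where "line s = (\<chi> i. u $ i + s * (v $ i - u $ i))" for s
  have line01: "line 0 = u" "line 1 = v"
    by (auto simp: line_def vec_eq_iff)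
  have on_line: "\<exists>r. \<forall>s. h (line s) = poly r s" if h: "polynomial_in UNIV h" for h
  proof -
    obtain p where "h = mpoly_eval p"
      using h unfolding polynomial_in_UNIV by blast
    then have "h (line s) = poly (\<Sum>e\<in>Poly_Mapping.keys p. smult (Poly_Mapping.lookup p e)
        (\<Prod>i\<in>UNIV. [:u $ i, v $ i - u $ i:] ^ Poly_Mapping.lookup e i)) s" for s
      by (simp add: mpoly_eval_def monom_eval_def line_def poly_sum poly_prod)
    then show ?thesis
      by blast
  qed
  obtain q r where qr: "\<And>s. f (line s) = poly q s" "\<And>s. g (line s) = poly r s"
    using on_line[OF assms(1)] on_line[OF assms(2)] by blast
  have "poly (q * r) s = 0" for s
    using assms(3)[of "line s"] by (simp add: qr)
  then have "q * r = 0"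
    using poly_all_0_iff_0 by blast
  then have "q = 0 \<or> r = 0"
    by simp
  then show False
    using uv qr(1)[of 0] qr(2)[of 1] by (auto simp: line01)
qed


section \<open>Algebraic independence\<close>

text \<open>
  The functions \<open>F j\<close> with \<open>j \<in> J\<close> are algebraically independent on \<open>Z\<close> if their power
  products are linearly independent there. An exponent vector only matters on \<open>J\<close>; asking that
  the vectors in \<open>E\<close> be distinguished by their values on \<open>J\<close>, rather than vanish outside \<open>J\<close>,
  lets the same \<open>E\<close> serve for different \<open>J\<close>.
\<close>

definition alg_independent_on ::
    "'j set \<Rightarrow> ('j \<Rightarrow> 'x \<Rightarrow> 'a::comm_ring_1) \<Rightarrow> 'x set \<Rightarrow> bool" where
  "alg_independent_on J F Z \<longleftrightarrow>
     (\<forall>E c. finite E \<longrightarrow> inj_on (\<lambda>e. restrict e J) E \<longrightarrow>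
        (\<forall>x\<in>Z. (\<Sum>e\<in>E. c e * (\<Prod>j\<in>J. F j x ^ e j)) = 0) \<longrightarrow> (\<forall>e\<in>E. c e = 0))"

lemma alg_independent_onD:
  assumes "alg_independent_on J F Z" "finite E" "inj_on (\<lambda>e. restrict e J) E"
    "\<And>x. x \<in> Z \<Longrightarrow> (\<Sum>e\<in>E. c e * (\<Prod>j\<in>J. F j x ^ e j)) = 0" "e \<in> E"
  shows "c e = 0"
  by (rule assms(1)[unfolded alg_independent_on_def, rule_format, OF assms(2,3) _ assms(5)])
    (rule assms(4))

lemma alg_independent_on_mono:
  assumes "alg_independent_on J F S" "S \<subseteq> Z"
  shows "alg_independent_on J F Z"
  unfolding alg_independent_on_def
proof (intro allI impI)
  fix E c
  assume "finite E" "inj_on (\<lambda>e. restrict e J) E"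
    "\<forall>x\<in>Z. (\<Sum>e\<in>E. c e * (\<Prod>j\<in>J. F j x ^ e j)) = 0"
  then show "\<forall>e\<in>E. c e = 0"
    using assms alg_independent_onD[of J F S E c] by blast
qed

lemma alg_independent_on_image:
  "alg_independent_on J F (h ` S) \<longleftrightarrow> alg_independent_on J (\<lambda>j x. F j (h x)) S"
  by (simp add: alg_independent_on_def)


subsection \<open>Too many polynomials are dependent\<close>

lemma underdetermined_system:
  fixes a :: "'e \<Rightarrow> 'b \<Rightarrow> 'a::field"
  assumes "finite B" "finite E" "card B < card E"
  shows "\<exists>c. (\<exists>e\<in>E. c e \<noteq> 0) \<and> (\<forall>b\<in>B. (\<Sum>e\<in>E. c e * a e b) = 0)"
  using assms
proof (induction B arbitrary: E a rule: finite_induct)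
  case empty
  then have "E \<noteq> {}"
    by auto
  then show ?case
    by (intro exI[of _ "\<lambda>_. 1"]) auto
next
  case (insert b B)
  show ?case
  proof (cases "\<forall>e\<in>E. a e b = 0")
    case True
    have "card B < card E"
      using insert.prems insert.hyps by simp
    then obtain c where "\<exists>e\<in>E. c e \<noteq> 0" "\<forall>b\<in>B. (\<Sum>e\<in>E. c e * a e b) = 0"
      using insert.IH[of E a] insert.prems(1) by blast
    then show ?thesis
      using True by (intro exI[of _ c]) simp
  next
    case False
    then obtain e0 where e0: "e0 \<in> E" "a e0 b \<noteq> 0"
      by blast
    \<comment> \<open>The equation for \<open>b\<close> is solved for the unknown \<open>e0\<close>, which is then eliminated from
      the other equations.\<close>
    define a' where "a' e d = a e d - a e b / a e0 b * a e0 d" for e d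
    have "card B < card (E - {e0})"
      using insert.prems insert.hyps e0 by auto
    then obtain c where c: "\<exists>e\<in>E - {e0}. c e \<noteq> 0"
        "\<forall>d\<in>B. (\<Sum>e\<in>E - {e0}. c e * a' e d) = 0"
      using insert.IH[of "E - {e0}" a'] insert.prems(1) by blast
    define s where "s = (\<Sum>e\<in>E - {e0}. c e * a e b)"
    define c' where "c' = c(e0 := - s / a e0 b)"
    have split: "(\<Sum>e\<in>E. c' e * a e d) =
        - s / a e0 b * a e0 d + (\<Sum>e\<in>E - {e0}. c e * a e d)" for d
    proof -
      have "(\<Sum>e\<in>E - {e0}. c' e * a e d) = (\<Sum>e\<in>E - {e0}. c e * a e d)"
        by (rule sum.cong) (simp_all add: c'_def)
      then show ?thesis
        using sum.remove[OF insert.prems(1) e0(1), of "\<lambda>e. c' e * a e d"] by (simp add: c'_def)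
    qed
    have "(\<Sum>e\<in>E. c' e * a e d) = 0" if d: "d \<in> insert b B" for d
    proof (cases "d = b")
      case True
      then show ?thesis
        using e0 split[of b] by (simp add: s_def)
    next
      case False
      then have "0 = (\<Sum>e\<in>E - {e0}. c e * a' e d)"
        using c(2) d by auto
      also have "\<dots> = (\<Sum>e\<in>E - {e0}. c e * a e d) - s / a e0 b * a e0 d"
        unfolding a'_def s_def
        by (simp add: right_diff_distrib sum_subtractf sum_divide_distrib sum_distrib_right mult.assoc)
      finally show ?thesis
        using split[of d] by simp
    qed
    moreover have "\<exists>e\<in>E. c' e \<noteq> 0"
    proof -
      obtain e where "e \<in> E" "e \<noteq> e0" "c e \<noteq> 0"
        using c(1) by blast
      then show ?thesis
        by (intro bexI[of _ e]) (simp_all add: c'_def)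
    qed
    ultimately show ?thesis
      by blast
  qed
qed

definition multidegree_le :: "('n \<Rightarrow> nat) \<Rightarrow> ('n, 'a::comm_ring_1) mpoly \<Rightarrow> bool" where
  "multidegree_le D p \<longleftrightarrow> (\<forall>e\<in>Poly_Mapping.keys p. \<forall>i. Poly_Mapping.lookup e i \<le> D i)"

lemma multidegree_le_one: "multidegree_le D 1"
  by (simp add: multidegree_le_def flip: Poly_Mapping.single_one)

lemma multidegree_le_mult:
  assumes "multidegree_le D p" "multidegree_le D' q"
  shows "multidegree_le (\<lambda>i. D i + D' i) (p * q)"
  unfolding multidegree_le_def
proof (intro ballI allI)
  fix e i assume "e \<in> Poly_Mapping.keys (p * q)"
  then obtain a b where "e = a + b" "a \<in> Poly_Mapping.keys p" "b \<in> Poly_Mapping.keys q"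
    using Poly_Mapping.keys_mult[of p q] by blast
  then show "Poly_Mapping.lookup e i \<le> D i + D' i"
    using assms by (auto simp: multidegree_le_def Poly_Mapping.lookup_add intro!: add_mono)
qed

lemma multidegree_le_power:
  "multidegree_le D p \<Longrightarrow> multidegree_le (\<lambda>i. k * D i) (p ^ k)"
proof (induction k)
  case (Suc k)
  then show ?case
    using multidegree_le_mult[of D p "\<lambda>i. k * D i" "p ^ k"] by simp
qed (simp add: multidegree_le_one)

lemma multidegree_le_prod:
  assumes "finite S" "\<And>s. s \<in> S \<Longrightarrow> multidegree_le (D s) (p s)"
  shows "multidegree_le (\<lambda>i. \<Sum>s\<in>S. D s i) (\<Prod>s\<in>S. p s)"
  using assms
  by (induction S rule: finite_induct) (simp_all add: multidegree_le_one multidegree_le_mult)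

lemma multidegree_le_mono:
  "multidegree_le D p \<Longrightarrow> (\<And>i. D i \<le> D' i) \<Longrightarrow> multidegree_le D' p"
  unfolding multidegree_le_def by (meson le_trans)

lemma card_bounded_exponents:
  fixes D :: "'n::finite \<Rightarrow> nat"
  defines "B \<equiv> {e :: 'n \<Rightarrow>\<^sub>0 nat. \<forall>i. Poly_Mapping.lookup e i \<le> D i}"
  shows "finite B" "card B \<le> (\<Prod>i\<in>UNIV. Suc (D i))"
proof -
  have inj: "inj_on Poly_Mapping.lookup B"
    by (simp add: inj_on_def Poly_Mapping.lookup_inject)
  have sub: "Poly_Mapping.lookup ` B \<subseteq> Pi\<^sub>E UNIV (\<lambda>i. {..D i})"
    by (auto simp: B_def)
  have fin: "finite (Pi\<^sub>E (UNIV :: 'n set) (\<lambda>i. {..D i}))"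
    by (auto intro: finite_PiE)
  show "finite B"
    using inj sub fin by (metis finite_imageD finite_subset)
  show "card B \<le> (\<Prod>i\<in>UNIV. Suc (D i))"
    using card_inj_on_le[OF inj sub fin] by (simp add: card_PiE)
qed

lemma polynomials_multidegree_bound:
  assumes "finite J" "\<And>j. j \<in> J \<Longrightarrow> polynomial_in I (F j)"
  obtains p d where "\<And>j. j \<in> J \<Longrightarrow> F j = mpoly_eval (p j)"
    "\<And>j. j \<in> J \<Longrightarrow> multidegree_le (\<lambda>i. if i \<in> I then d else 0) (p j)"
proof -
  obtain p where p: "\<And>j e. j \<in> J \<Longrightarrow> e \<in> Poly_Mapping.keys (p j) \<Longrightarrow> Poly_Mapping.keys e \<subseteq> I"
      "\<And>j. j \<in> J \<Longrightarrow> F j = mpoly_eval (p j)"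
    using assms(2) unfolding polynomial_in_def by metis
  define S where "S = (\<Union>j\<in>J. \<Union>e\<in>Poly_Mapping.keys (p j). range (Poly_Mapping.lookup e))"
  have "finite S"
    unfolding S_def using assms(1) by auto
  then have le: "s \<le> Max S" if "s \<in> S" for s
    using that by simp
  have "multidegree_le (\<lambda>i. if i \<in> I then Max S else 0) (p j)" if j: "j \<in> J" for j
    unfolding multidegree_le_def
  proof (intro ballI allI)
    fix e i assume e: "e \<in> Poly_Mapping.keys (p j)"
    show "Poly_Mapping.lookup e i \<le> (if i \<in> I then Max S else 0)"
    proof (cases "i \<in> I")
      case True
      have "Poly_Mapping.lookup e i \<in> S"
        using e j unfolding S_def by blast
      then show ?thesis
        using True le by simp
    next
      case False
      then show ?thesis
        using p(1)[OF j e] by (auto simp: Poly_Mapping.in_keys_iff)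
    qed
  qed
  with p(2) show ?thesis
    by (rule that)
qed

text \<open>
  The power products of the \<open>F j\<close> with exponents at most \<open>N\<close> number \<open>(N + 1) ^ card J\<close>, while
  the monomials that can occur in them have exponents of size \<open>O(N)\<close> in the variables from \<open>I\<close>,
  so there are only \<open>O(N ^ card I)\<close> of these. For large \<open>N\<close> a linear relation is forced.
\<close>

lemma not_alg_independent_if_card_less:
  fixes F :: "'j \<Rightarrow> 'a::field ^ 'm::finite \<Rightarrow> 'a"
  assumes "finite J" "\<And>j. j \<in> J \<Longrightarrow> polynomial_in I (F j)" "card I < card J"
  shows "\<not> alg_independent_on J F UNIV"
proof
  assume indep: "alg_independent_on J F UNIV"
  obtain p d where p: "\<And>j. j \<in> J \<Longrightarrow> F j = mpoly_eval (p j)"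
    and d: "\<And>j. j \<in> J \<Longrightarrow> multidegree_le (\<lambda>i. if i \<in> I then d else 0) (p j)"
    using polynomials_multidegree_bound[OF assms(1), of I F] assms(2) by blast
  define K where "K = Suc (card J * d)"
  define N where "N = K ^ card I"
  define E where "E = Pi\<^sub>E J (\<lambda>_. {..N})"
  define D where "D i = (if i \<in> I then card J * (N * d) else 0)" for i
  define B where "B = {e :: 'm \<Rightarrow>\<^sub>0 nat. \<forall>i. Poly_Mapping.lookup e i \<le> D i}"
  define q where "q e = (\<Prod>j\<in>J. p j ^ e j)" for e
  have finE: "finite E" and cardE: "card E = Suc N ^ card J"
    using assms(1) by (auto simp: E_def card_PiE intro: finite_PiE)
  have finB: "finite B"
    unfolding B_def by (rule card_bounded_exponents)
  have "card B \<le> (\<Prod>i\<in>UNIV. Suc (D i))"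
    unfolding B_def by (rule card_bounded_exponents)
  also have "\<dots> = (\<Prod>i\<in>I. Suc (card J * (N * d)))"
    by (rule prod.mono_neutral_cong_right) (auto simp: D_def)
  also have "\<dots> = Suc (card J * (N * d)) ^ card I"
    by simp
  also have "\<dots> \<le> (K * Suc N) ^ card I"
    by (rule power_mono) (auto simp: K_def algebra_simps)
  also have "\<dots> = N * Suc N ^ card I"
    by (simp only: power_mult_distrib N_def)
  also have "\<dots> < Suc N ^ Suc (card I)"
    by simp
  also have "\<dots> \<le> card E"
    unfolding cardE using assms(3) by (intro power_increasing) auto
  finally obtain c where c: "\<exists>e\<in>E. c e \<noteq> 0"
      "\<forall>b\<in>B. (\<Sum>e\<in>E. c e * Poly_Mapping.lookup (q e) b) = 0"
    using underdetermined_system[OF finB finE, of "\<lambda>e. Poly_Mapping.lookup (q e)"] by blast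
  have keys: "Poly_Mapping.keys (q e) \<subseteq> B" if e: "e \<in> E" for e
  proof -
    have "multidegree_le (\<lambda>i. \<Sum>j\<in>J. e j * (if i \<in> I then d else 0)) (q e)"
      unfolding q_def by (intro multidegree_le_prod multidegree_le_power d assms(1))
    then have "multidegree_le D (q e)"
    proof (rule multidegree_le_mono)
      fix i
      have "e j * (if i \<in> I then d else 0) \<le> (if i \<in> I then N * d else 0)" if "j \<in> J" for j
        using e that by (auto simp: E_def PiE_iff)
      then have "(\<Sum>j\<in>J. e j * (if i \<in> I then d else 0)) \<le> (\<Sum>j\<in>J. if i \<in> I then N * d else 0)"
        by (rule sum_mono)
      also have "\<dots> = D i"
        by (simp add: D_def)
      finally show "(\<Sum>j\<in>J. e j * (if i \<in> I then d else 0)) \<le> D i" .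
    qed
    then show ?thesis
      by (auto simp: multidegree_le_def B_def)
  qed
  have q_eval: "mpoly_eval (q e) x = (\<Prod>j\<in>J. F j x ^ e j)" for e x
  proof -
    have pow: "mpoly_eval (r ^ k) x = mpoly_eval r x ^ k" for r :: "('m, 'a) mpoly" and k
      by (induction k) (simp_all add: mpoly_eval_mult)
    have "mpoly_eval (\<Prod>j\<in>J. p j ^ e j) x = (\<Prod>j\<in>J. mpoly_eval (p j) x ^ e j)"
      using assms(1) by (induction J rule: finite_induct) (simp_all add: mpoly_eval_mult pow)
    then show ?thesis
      using p by (simp add: q_def)
  qed
  have "(\<Sum>e\<in>E. c e * (\<Prod>j\<in>J. F j x ^ e j)) = 0" for x
  proof -
    have "(\<Sum>e\<in>E. c e * (\<Prod>j\<in>J. F j x ^ e j)) =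
        (\<Sum>e\<in>E. c e * (\<Sum>b\<in>B. Poly_Mapping.lookup (q e) b * monom_eval b x))"
      by (rule sum.cong) (simp_all add: mpoly_eval_superset[OF finB keys] flip: q_eval)
    also have "\<dots> = (\<Sum>e\<in>E. \<Sum>b\<in>B. c e * Poly_Mapping.lookup (q e) b * monom_eval b x)"
      by (simp add: sum_distrib_left mult.assoc)
    also have "\<dots> = (\<Sum>b\<in>B. \<Sum>e\<in>E. c e * Poly_Mapping.lookup (q e) b * monom_eval b x)"
      by (rule sum.swap)
    also have "\<dots> = (\<Sum>b\<in>B. (\<Sum>e\<in>E. c e * Poly_Mapping.lookup (q e) b) * monom_eval b x)"
      by (simp add: sum_distrib_right)
    also have "\<dots> = 0"
      using c(2) by simp
    finally show ?thesis .
  qed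
  moreover have "inj_on (\<lambda>e. restrict e J) E"
    by (auto simp: inj_on_def E_def PiE_iff extensional_restrict)
  ultimately show False
    using alg_independent_onD[OF indep finE] c(1) by blast
qed


section \<open>Zariski closures and irreducible sets\<close>

lemma vanishing_on_zariski_closure:
  assumes "polynomial_in UNIV f"
  shows "(\<forall>x\<in>zariski_topology closure_of S. f x = 0) \<longleftrightarrow> (\<forall>x\<in>S. f x = 0)"
proof
  have "S \<subseteq> zariski_topology closure_of S"
    by (rule closure_of_subset) simp
  then show "\<forall>x\<in>S. f x = 0" if "\<forall>x\<in>zariski_topology closure_of S. f x = 0"
    using that by blast
  obtain p where p: "f = mpoly_eval p"
    using assms unfolding polynomial_in_UNIV by blast
  assume "\<forall>x\<in>S. f x = 0"
  then have "S \<subseteq> zero_locus {p}"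
    by (auto simp: zero_locus_def p)
  then have "zariski_topology closure_of S \<subseteq> zero_locus {p}"
    by (rule closure_of_minimal) (auto simp: closedin_zariski)
  then show "\<forall>x\<in>zariski_topology closure_of S. f x = 0"
    by (auto simp: zero_locus_def p)
qed

lemma alg_independent_on_zariski_closure:
  assumes "\<And>j. j \<in> J \<Longrightarrow> polynomial_in UNIV (F j)"
  shows "alg_independent_on J F (zariski_topology closure_of S) \<longleftrightarrow> alg_independent_on J F S"
proof -
  have "polynomial_in UNIV (\<lambda>x. \<Sum>e\<in>E. c e * (\<Prod>j\<in>J. F j x ^ e j))" for E c
    by (intro polynomial_in_sum polynomial_in_mult polynomial_in_prod polynomial_in_power
        polynomial_in_const assms)
  then show ?thesis
    unfolding alg_independent_on_def by (simp only: vanishing_on_zariski_closure)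
qed

lemma irreducible_in_subtopologyD:
  assumes "irreducible_in (subtopology zariski_topology V) W"
    "polynomial_in UNIV f" "polynomial_in UNIV g" "\<And>x. x \<in> W \<Longrightarrow> f x * g x = 0"
  shows "(\<forall>x\<in>W. f x = 0) \<or> (\<forall>x\<in>W. g x = 0)"
proof -
  obtain p q where pq: "f = mpoly_eval p" "g = mpoly_eval q"
    using assms(2,3) unfolding polynomial_in_UNIV by blast
  have closed: "closedin (subtopology zariski_topology V) (zero_locus {r} \<inter> V)" for r
    unfolding closedin_subtopology closedin_zariski by blast
  have "W \<subseteq> V"
    using assms(1) by (simp add: irreducible_in_def)
  moreover have "W \<subseteq> zero_locus {p} \<union> zero_locus {q}"
    using assms(4) by (auto simp: zero_locus_def pq)
  ultimately have "W \<subseteq> zero_locus {p} \<inter> V \<union> zero_locus {q} \<inter> V"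
    by blast
  then have "W \<subseteq> zero_locus {p} \<inter> V \<or> W \<subseteq> zero_locus {q} \<inter> V"
    using assms(1) closed unfolding irreducible_in_def by blast
  then show ?thesis
    by (auto simp: zero_locus_def pq)
qed

text \<open>
  Affine space is irreducible because polynomial functions on it have no zero divisors, and
  irreducibility passes to the closure of a polynomial image.
\<close>

lemma irreducible_in_closure_of_polynomial_image:
  fixes h :: "'a::field_char_0 ^ 'm::finite \<Rightarrow> 'a ^ 'n::finite"
  assumes "\<And>j. polynomial_in UNIV (\<lambda>t. h t $ j)"
    and "zariski_topology closure_of (range h) \<subseteq> V"
  shows "irreducible_in (subtopology zariski_topology V) (zariski_topology closure_of (range h))"
proof -
  let ?Z = "zariski_topology closure_of (range h)"
  have sub: "range h \<subseteq> ?Z"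
    by (rule closure_of_subset) simp
  have "?Z \<subseteq> C \<or> ?Z \<subseteq> D"
    if C: "closedin (subtopology zariski_topology V) C"
      and D: "closedin (subtopology zariski_topology V) D" and CD: "?Z \<subseteq> C \<union> D" for C D
  proof (rule ccontr)
    assume contra: "\<not> (?Z \<subseteq> C \<or> ?Z \<subseteq> D)"
    obtain P Q where P: "C = zero_locus P \<inter> V" and Q: "D = zero_locus Q \<inter> V"
      using C D unfolding closedin_subtopology closedin_zariski by blast
    obtain p where p: "p \<in> P" "\<not> (\<forall>x\<in>?Z. mpoly_eval p x = 0)"
      using contra assms(2) unfolding P zero_locus_def by blast
    obtain q where q: "q \<in> Q" "\<not> (\<forall>x\<in>?Z. mpoly_eval q x = 0)"
      using contra assms(2) unfolding Q zero_locus_def by blast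
    have poly: "polynomial_in UNIV (mpoly_eval r)" for r :: "('n, 'a) mpoly"
      unfolding polynomial_in_UNIV by blast
    have "mpoly_eval p (h t) * mpoly_eval q (h t) = 0" for t
    proof -
      have "h t \<in> C \<union> D"
        using sub CD by blast
      then show ?thesis
        using p(1) q(1) by (auto simp: P Q zero_locus_def)
    qed
    then have "(\<forall>t. mpoly_eval p (h t) = 0) \<or> (\<forall>t. mpoly_eval q (h t) = 0)"
      by (rule polynomial_in_mult_eq_0[OF polynomial_in_compose[OF poly assms(1)]
            polynomial_in_compose[OF poly assms(1)]])
    then show False
      using p(2) q(2) by (auto simp: vanishing_on_zariski_closure[OF poly])
  qed
  then show ?thesis
    unfolding irreducible_in_def using assms(2) sub by auto
qed


section \<open>Chains of irreducible closed sets\<close>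

text \<open>
  A polynomial \<open>F k\<close> that vanishes on \<open>Z\<close> but not on the larger irreducible set \<open>W\<close> is
  independent on \<open>W\<close> of any functions that are independent on \<open>Z\<close>. In a relation on \<open>W\<close> the
  highest common power of \<open>F k\<close> can be cancelled, since \<open>W\<close> is irreducible; setting
  \<open>F k = 0\<close> in what remains gives a non-trivial relation on \<open>Z\<close> among the other functions.
\<close>

lemma alg_independent_on_insert:
  fixes F :: "'j \<Rightarrow> 'a::idom ^ 'n::finite \<Rightarrow> 'a"
  assumes "finite J" "k \<notin> J" and indep: "alg_independent_on J F Z" and "Z \<subseteq> W"
    and irr: "irreducible_in (subtopology zariski_topology V) W"
    and poly: "\<And>j. j \<in> insert k J \<Longrightarrow> polynomial_in UNIV (F j)"
    and zero: "\<And>x. x \<in> Z \<Longrightarrow> F k x = 0" and nonzero: "y \<in> W" "F k y \<noteq> 0"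
  shows "alg_independent_on (insert k J) F W"
  unfolding alg_independent_on_def
proof (intro allI impI, rule ccontr)
  fix E c
  assume E: "finite E" "inj_on (\<lambda>e. restrict e (insert k J)) E"
    and rel: "\<forall>x\<in>W. (\<Sum>e\<in>E. c e * (\<Prod>j\<in>insert k J. F j x ^ e j)) = 0"
    and c: "\<not> (\<forall>e\<in>E. c e = 0)"
  define S where "S = {e \<in> E. c e \<noteq> 0}"
  define r where "r = Min ((\<lambda>e. e k) ` S)"
  define S0 where "S0 = {e \<in> S. e k = r}"
  define g where "g e x = (\<Prod>j\<in>J. F j x ^ e j)" for e x
  define Q where "Q x = (\<Sum>e\<in>S. c e * (F k x ^ (e k - r) * g e x))" for x
  have S: "finite S" "S \<noteq> {}"
    using E(1) c by (auto simp: S_def)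
  then have le: "r \<le> e k" if "e \<in> S" for e
    using that by (simp add: r_def)
  have "r \<in> (\<lambda>e. e k) ` S"
    unfolding r_def using S by (intro Min_in) auto
  then obtain e0 where e0: "e0 \<in> S0"
    by (auto simp: S0_def)
  have "F k x ^ r * Q x = 0" if x: "x \<in> W" for x
  proof -
    have "F k x ^ r * Q x = (\<Sum>e\<in>S. c e * ((F k x ^ r * F k x ^ (e k - r)) * g e x))"
      by (simp add: Q_def sum_distrib_left mult_ac)
    also have "\<dots> = (\<Sum>e\<in>S. c e * (\<Prod>j\<in>insert k J. F j x ^ e j))"
      using assms(1,2) le by (intro sum.cong) (simp_all add: g_def flip: power_add)
    also have "\<dots> = (\<Sum>e\<in>E. c e * (\<Prod>j\<in>insert k J. F j x ^ e j))"
      using E(1) by (intro sum.mono_neutral_left) (auto simp: S_def)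
    finally show ?thesis
      using rel x by simp
  qed
  moreover have "polynomial_in UNIV Q"
    unfolding Q_def g_def
    by (intro polynomial_in_sum polynomial_in_mult polynomial_in_prod polynomial_in_power
        polynomial_in_const poly) auto
  moreover have "polynomial_in UNIV (\<lambda>x. F k x ^ r)"
    by (intro polynomial_in_power poly) simp
  ultimately have "(\<forall>x\<in>W. F k x ^ r = 0) \<or> (\<forall>x\<in>W. Q x = 0)"
    by (intro irreducible_in_subtopologyD[OF irr])
  then have Q0: "\<forall>x\<in>W. Q x = 0"
    using nonzero by auto
  have rel0: "(\<Sum>e\<in>S0. c e * (\<Prod>j\<in>J. F j x ^ e j)) = 0" if x: "x \<in> Z" for x
  proof -
    have "Q x = (\<Sum>e\<in>S. if e k = r then c e * g e x else 0)"
      unfolding Q_def using zero[OF x]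
      by (intro sum.cong) (auto simp: power_0_left dest: le intro: antisym)
    also have "\<dots> = (\<Sum>e\<in>S0. c e * g e x)"
      unfolding S0_def using S(1) by (simp add: sum.If_cases Int_def)
    finally show ?thesis
      using Q0 x assms(4) by (auto simp: g_def)
  qed
  have inj0: "inj_on (\<lambda>e. restrict e J) S0"
  proof (rule inj_onI)
    fix e e' assume *: "e \<in> S0" "e' \<in> S0" "restrict e J = restrict e' J"
    have "e j = e' j" if "j \<in> J" for j
      using fun_cong[OF *(3), of j] that by simp
    then have "restrict e (insert k J) = restrict e' (insert k J)"
      using *(1,2) by (auto simp: S0_def restrict_def)
    then show "e = e'"
      using E(2) *(1,2) by (auto simp: S0_def S_def inj_on_def)
  qed
  have "finite S0"
    using S by (simp add: S0_def)
  then have "c e0 = 0"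
    by (rule alg_independent_onD[OF indep _ inj0 rel0 e0])
  then show False
    using e0 by (simp add: S0_def S_def)
qed

lemma alg_independent_on_cong:
  assumes "\<And>j. j \<in> J \<Longrightarrow> F j = G j"
  shows "alg_independent_on J F Z \<longleftrightarrow> alg_independent_on J G Z"
proof -
  have "(\<Prod>j\<in>J. F j x ^ e j) = (\<Prod>j\<in>J. G j x ^ e j)" for x and e :: "'a \<Rightarrow> nat"
    by (rule prod.cong) (simp_all add: assms)
  then show ?thesis
    by (simp add: alg_independent_on_def)
qed

lemma chain_alg_independent:
  fixes V :: "('a::idom ^ 'n::finite) set"
  defines "X \<equiv> subtopology zariski_topology V"
  assumes "\<And>i. i \<le> k \<Longrightarrow> closedin X (Z i)" "\<And>i. i \<le> k \<Longrightarrow> irreducible_in X (Z i)"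
    "\<And>i. i < k \<Longrightarrow> Z i \<subset> Z (Suc i)"
  shows "\<exists>F :: nat \<Rightarrow> 'a ^ 'n \<Rightarrow> 'a.
    (\<forall>j<k. polynomial_in UNIV (F j)) \<and> alg_independent_on {..<k} F (Z k)"
  using assms(2-)
proof (induction k)
  case 0
  then obtain x where "x \<in> Z 0"
    by (auto simp: irreducible_in_def)
  \<comment> \<open>Only one exponent vector is available on the empty index set, and \<open>Z 0\<close> has a point.\<close>
  have "c e = 0" if E: "finite E" "inj_on (\<lambda>e :: nat \<Rightarrow> nat. restrict e {}) E" "e \<in> E"
    and rel: "\<forall>x\<in>Z 0. (\<Sum>e\<in>E. c e * (1 :: 'a)) = 0" for E c e
  proof -
    have "E = {e}"
      using E by (auto simp: inj_on_def restrict_def)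
    then show ?thesis
      using rel \<open>x \<in> Z 0\<close> by auto
  qed
  then show ?case
    by (auto simp: alg_independent_on_def)
next
  case (Suc k)
  obtain F :: "nat \<Rightarrow> 'a ^ 'n \<Rightarrow> 'a" where F: "\<And>j. j < k \<Longrightarrow> polynomial_in UNIV (F j)"
    "alg_independent_on {..<k} F (Z k)"
    using Suc.IH Suc.prems by auto
  obtain y where y: "y \<in> Z (Suc k)" "y \<notin> Z k"
    using Suc.prems(3)[of k] by auto
  obtain P where P: "Z k = zero_locus P \<inter> V"
    using Suc.prems(1)[of k] unfolding X_def closedin_subtopology closedin_zariski by auto
  have "y \<in> V"
    using y(1) Suc.prems(2)[of "Suc k"] by (auto simp: irreducible_in_def X_def)
  then obtain p where p: "p \<in> P" "mpoly_eval p y \<noteq> 0"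
    using y(2) by (auto simp: P zero_locus_def)
  define G where "G = F(k := mpoly_eval p)"
  have G: "G k = mpoly_eval p" "\<And>j. j < k \<Longrightarrow> G j = F j"
    by (auto simp: G_def)
  have poly: "polynomial_in UNIV (G j)" if "j < Suc k" for j
  proof (cases "j = k")
    case True
    then show ?thesis
      unfolding polynomial_in_UNIV by (auto simp: G)
  next
    case False
    then show ?thesis
      using that F(1) by (simp add: G)
  qed
  have "alg_independent_on (insert k {..<k}) G (Z (Suc k))"
  proof (rule alg_independent_on_insert)
    show "alg_independent_on {..<k} G (Z k)"
      using F(2) G(2) alg_independent_on_cong[of "{..<k}" G F] by simp
    show "irreducible_in (subtopology zariski_topology V) (Z (Suc k))"
      using Suc.prems(2)[of "Suc k"] by (simp add: X_def)
    show "Z k \<subseteq> Z (Suc k)"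
      using Suc.prems(3)[of k] by auto
    show "G k x = 0" if "x \<in> Z k" for x
      using that p(1) by (auto simp: P G zero_locus_def)
    show "G k y \<noteq> 0"
      using p(2) by (simp add: G)
    show "polynomial_in UNIV (G j)" if "j \<in> insert k {..<k}" for j
      using that by (intro poly) auto
  qed (use y in auto)
  then show ?case
    using poly by (auto simp: lessThan_Suc)
qed


section \<open>Independence of tensor product Chebyshev polynomials\<close>

lemma poly_chebyshev_T_1 [simp]: "poly (chebyshev_T k) 1 = 1"
  by (induction k rule: chebyshev_T.induct) simp_all

lemma degree_chebyshev_T [simp]:
  "degree (chebyshev_T k :: 'a::{idom, ring_char_0} poly) = k"
proof (induction k rule: chebyshev_T.induct)
  case (3 k)
  have nz: "chebyshev_T (Suc k) \<noteq> (0 :: 'a poly)"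
    using poly_chebyshev_T_1[of "Suc k", where ?'a = 'a] by force
  have "2 * [:0, 1:] * chebyshev_T (Suc k) = [:0, 2:] * (chebyshev_T (Suc k) :: 'a poly)"
    by (simp add: numeral_poly)
  then have deg: "degree (2 * [:0, 1:] * chebyshev_T (Suc k) :: 'a poly) = Suc (Suc k)"
    using nz 3 by (simp only: degree_mult_eq) simp
  have "degree (2 * [:0, 1:] * chebyshev_T (Suc k) + - chebyshev_T k :: 'a poly) = Suc (Suc k)"
    by (subst degree_add_eq_left) (use deg 3 in simp_all)
  then show ?case
    by simp
qed simp_all

lemma chebyshev_T_nonzero [simp]: "chebyshev_T k \<noteq> (0 :: 'a::comm_ring_1 poly)"
  using poly_chebyshev_T_1[of k, where ?'a = 'a] by force

text \<open>
  Since every \<open>T\<^sub>k\<close> takes the value \<open>1\<close> at \<open>1\<close>, setting the variables outside \<open>I\<close> to \<open>1\<close>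
  turns the tensor product polynomials of \<open>A\<close> into those of the submatrix with rows \<open>I\<close>.
\<close>

definition ones_outside :: "'m set \<Rightarrow> 'a::one ^ 'm \<Rightarrow> 'a ^ 'm" where
  "ones_outside I t = (\<chi> i. if i \<in> I then t $ i else 1)"

lemma tensor_chebyshev_ones_outside:
  "tensor_chebyshev a (ones_outside I t) = (\<Prod>i\<in>I. poly (chebyshev_T (a $ i)) (t $ i))"
  unfolding tensor_chebyshev_def
  by (rule prod.mono_neutral_cong_right) (auto simp: ones_outside_def)

lemma polynomial_in_tensor_chebyshev_map:
  "polynomial_in I (\<lambda>t. tensor_chebyshev_map A (ones_outside I t) $ j)"
  by (simp add: tensor_chebyshev_map_def tensor_chebyshev_ones_outside polynomial_in_prod
      polynomial_in_compose_poly polynomial_in_coord)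

lemma coeff_relation_if_poly_relation:
  fixes R :: "'e \<Rightarrow> 'i \<Rightarrow> 'a::{comm_ring_1, ring_no_zero_divisors, ring_char_0} poly"
  assumes "finite I" "\<And>t. (\<Sum>e\<in>E. c e * (\<Prod>i\<in>I. poly (R e i) (t i))) = 0"
  shows "(\<Sum>e\<in>E. c e * (\<Prod>i\<in>I. coeff (R e i) (d i))) = 0"
  using assms
proof (induction I arbitrary: c rule: finite_induct)
  case (insert i I)
  have "(\<Sum>e\<in>E. c e * coeff (R e i) (d i) * (\<Prod>l\<in>I. poly (R e l) (t l))) = 0" for t
  proof -
    define q where "q = (\<Sum>e\<in>E. smult (c e * (\<Prod>l\<in>I. poly (R e l) (t l))) (R e i))"
    have "poly q s = 0" for s
    proof -
      have upd: "(\<Prod>l\<in>I. poly (R e l) ((t(i := s)) l)) = (\<Prod>l\<in>I. poly (R e l) (t l))" for e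
        using insert.hyps by (intro prod.cong) auto
      have "poly q s = (\<Sum>e\<in>E. c e * (\<Prod>l\<in>insert i I. poly (R e l) ((t(i := s)) l)))"
        using insert.hyps
        by (simp add: q_def poly_sum upd del: fun_upd_apply) (simp add: mult_ac)
      then show ?thesis
        using insert.prems by simp
    qed
    then have "coeff q (d i) = 0"
      using poly_all_0_iff_0 by (metis coeff_0)
    then show ?thesis
      by (simp add: q_def coeff_sum mult_ac)
  qed
  from insert.IH[of "\<lambda>e. c e * coeff (R e i) (d i)", OF this] show ?case
    using insert.hyps by (simp add: mult.assoc)
qed simp

text \<open>
  The power product with exponents \<open>e\<close> has degree \<open>w e i = (\<Sum>j\<in>J. A $ i $ j * e j)\<close> in the
  \<open>i\<close>-th variable, and the monomial with exponents \<open>w e\<close> does occur in it. The vectors \<open>w e\<close>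
  are distinct for distinct \<open>e\<close>, so in a relation the top monomial of a power product for which
  \<open>w e\<close> is maximal cannot be cancelled.
\<close>

lemma alg_independent_tensor_chebyshev:
  fixes A :: "nat ^ 'n ^ 'm"
  assumes "\<And>e e'. (\<And>i. i \<in> I \<Longrightarrow> (\<Sum>j\<in>J. A $ i $ j * e j) = (\<Sum>j\<in>J. A $ i $ j * e' j))
    \<Longrightarrow> restrict e J = restrict e' J"
  shows "alg_independent_on J (\<lambda>j t. tensor_chebyshev_map A (ones_outside I t) $ j) UNIV"
  unfolding alg_independent_on_def
proof (intro allI impI, rule ccontr)
  fix E c
  assume E: "finite E" "inj_on (\<lambda>e. restrict e J) E"
    and rel: "\<forall>t\<in>UNIV. (\<Sum>e\<in>E. c e *
      (\<Prod>j\<in>J. tensor_chebyshev_map A (ones_outside I t) $ j ^ e j)) = 0"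
    and c: "\<not> (\<forall>e\<in>E. c e = 0)"
  define R where "R e i = (\<Prod>j\<in>J. chebyshev_T (A $ i $ j) ^ e j :: complex poly)"
    for e :: "'n \<Rightarrow> nat" and i
  define w where "w e i = (\<Sum>j\<in>J. A $ i $ j * e j)" for e i
  have degR: "degree (R e i) = w e i" for e i
    unfolding R_def w_def
    by (subst degree_prod_sum_eq) (auto simp: degree_power_eq mult.commute)
  have R0: "R e i \<noteq> 0" for e i
    by (simp add: R_def)
  have finI: "finite I"
    by simp
  define S where "S = {e \<in> E. c e \<noteq> 0}"
  have S: "finite S" "S \<noteq> {}"
    using E(1) c by (auto simp: S_def)
  \<comment> \<open>Maximality of the sum of the entries implies maximality in the product order.\<close>
  have "Max ((\<lambda>e. \<Sum>i\<in>I. w e i) ` S) \<in> (\<lambda>e. \<Sum>i\<in>I. w e i) ` S"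
    using S by (intro Max_in) auto
  then obtain e0 where e0: "e0 \<in> S"
    and "(\<Sum>i\<in>I. w e0 i) = Max ((\<lambda>e. \<Sum>i\<in>I. w e i) ` S)"
    by auto
  then have max: "(\<Sum>i\<in>I. w e i) \<le> (\<Sum>i\<in>I. w e0 i)" if "e \<in> S" for e
    using S(1) that by simp
  have "(\<Sum>e\<in>E. c e * (\<Prod>i\<in>I. poly (R e i) (t i))) = 0" for t
  proof -
    have "(\<Prod>i\<in>I. poly (R e i) (t i)) =
        (\<Prod>j\<in>J. tensor_chebyshev_map A (ones_outside I (\<chi> i. t i)) $ j ^ e j)" for e
      by (simp add: tensor_chebyshev_map_def tensor_chebyshev_ones_outside column_def R_def
          poly_prod prod_power_distrib) (rule prod.swap)
    then show ?thesis
      using rel by simp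
  qed
  from coeff_relation_if_poly_relation[OF finI this, of "w e0", symmetric]
  have "0 = (\<Sum>e\<in>E. c e * (\<Prod>i\<in>I. coeff (R e i) (w e0 i)))" .
  also have "\<dots> = (\<Sum>e\<in>{e0}. c e * (\<Prod>i\<in>I. coeff (R e i) (w e0 i)))"
  proof (rule sum.mono_neutral_right)
    show "\<forall>e\<in>E - {e0}. c e * (\<Prod>i\<in>I. coeff (R e i) (w e0 i)) = 0"
    proof (intro ballI, rule ccontr)
      fix e assume e: "e \<in> E - {e0}" and nz: "c e * (\<Prod>i\<in>I. coeff (R e i) (w e0 i)) \<noteq> 0"
      have le: "w e0 i \<le> w e i" if "i \<in> I" for i
        using nz that finI by (auto simp flip: degR[of e] intro!: le_degree)
      have "e \<in> S"
        using e nz by (auto simp: S_def)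
      then have "(\<Sum>i\<in>I. w e0 i) = (\<Sum>i\<in>I. w e i)"
        using max le by (simp add: antisym sum_mono)
      then have "w e0 i = w e i" if "i \<in> I" for i
        using sum_mono_inv[of "w e0" I "w e" i] le that finI by blast
      then have "restrict e0 J = restrict e J"
        by (intro assms) (simp add: w_def)
      then show False
        using E(2) e e0 by (auto simp: inj_on_def S_def)
    qed
  qed (use E e0 in \<open>auto simp: S_def\<close>)
  also have "\<dots> = c e0 * (\<Prod>i\<in>I. lead_coeff (R e0 i))"
    by (simp add: degR)
  finally show False
    using e0 R0 finI by (simp add: S_def)
qed


section \<open>The dimension\<close>

text \<open>
  The columns, with the entries outside the rows \<open>I\<close> replaced by \<open>0\<close>, span the coordinate
  subspace of \<open>I\<close>, because \<open>M\<close> is surjective. A basis of this space can be chosen among them.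
\<close>

lemma independent_columns_of_full_row_rank:
  fixes M :: "real ^ 'n ^ 'm"
  assumes "rank M = CARD('m)"
  obtains J where "card J = card I"
    "\<And>u. \<forall>i\<in>I. (\<Sum>j\<in>J. M $ i $ j * u j) = 0 \<Longrightarrow> \<forall>j\<in>J. u j = 0"
proof -
  define v where "v j = (\<chi> i. if i \<in> I then M $ i $ j else 0)" for j
  let ?S = "{x :: real ^ 'm. \<forall>i. i \<notin> I \<longrightarrow> x $ i = 0}"
  have "?S \<subseteq> vec.span (range v)"
  proof
    fix x assume x: "x \<in> ?S"
    obtain y where y: "x = M *v y"
      using assms full_rank_surjective[of M] by (metis surjD)
    have "x $ i = (\<Sum>j\<in>UNIV. y $ j * v j $ i)" for i
      using x y
      by (cases "i \<in> I") (simp_all add: v_def matrix_vector_mult_def mult.commute)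
    then have "x = (\<Sum>j\<in>UNIV. (y $ j) *s v j)"
      by (simp add: vec_eq_iff)
    also have "\<dots> \<in> vec.span (range v)"
      by (intro vec.span_sum vec.span_scale vec.span_base) auto
    finally show "x \<in> vec.span (range v)" .
  qed
  then have "vec.dim ?S \<le> vec.dim (range v)"
    by (rule vec.dim_mono)
  moreover have "vec.dim (range v) \<le> vec.dim ?S"
    by (rule vec.dim_subset) (auto simp: v_def)
  ultimately have dim: "vec.dim (range v) = card I"
    by (simp add: dim_substandard_cart)
  obtain B where B: "B \<subseteq> range v" "vec.independent B" "card B = card I"
    by (rule vec.basis_exists[of "range v"]) (simp add: dim)
  then obtain J where J: "inj_on v J" "B = v ` J"
    using subset_image_inj[of B v UNIV] by auto
  show ?thesis
  proof (rule that)
    show "card J = card I"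
      using B(3) J by (simp add: card_image)
    fix u assume u: "\<forall>i\<in>I. (\<Sum>j\<in>J. M $ i $ j * u j) = 0"
    show "\<forall>j\<in>J. u j = 0"
    proof
      fix j assume j: "j \<in> J"
      have "(\<Sum>b\<in>B. u (the_inv_into J v b) *s b) = (\<Sum>j\<in>J. u j *s v j)"
        using J by (simp add: sum.reindex the_inv_into_f_f)
      also have "\<dots> = 0"
      proof -
        have "(\<Sum>j\<in>J. u j * v j $ i) = 0" for i
          using u by (cases "i \<in> I") (simp_all add: v_def mult.commute)
        then show ?thesis
          by (simp add: vec_eq_iff)
      qed
      finally have "u (the_inv_into J v (v j)) = 0"
        using B(2) j J(2) by (intro vec.independentD[OF B(2), of B "\<lambda>b. u (the_inv_into J v b)"]) auto
      then show "u j = 0"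
        using J(1) j by (simp add: the_inv_into_f_f)
    qed
  qed
qed

theorem theorem4p2:
  fixes A :: "nat ^ 'n ^ 'm"
  assumes "rank (map_matrix real A) = CARD('m)"
  shows "zariski_dimension (tensor_chebyshev_variety A) = ereal (real CARD('m))"
proof -
  define V where "V = tensor_chebyshev_variety A"
  define X where "X = subtopology zariski_topology V"
  define \<phi> where "\<phi> I t = tensor_chebyshev_map A (ones_outside I t)" for I t
  define W where "W I = zariski_topology closure_of (range (\<phi> I))" for I
  have V: "V = W UNIV"
    by (simp add: V_def W_def \<phi>_def[abs_def] tensor_chebyshev_variety_def ones_outside_def)
  have poly_\<phi>: "polynomial_in I (\<lambda>t. \<phi> I t $ j)" for I j
    unfolding \<phi>_def by (rule polynomial_in_tensor_chebyshev_map)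
  have poly_\<phi>_UNIV: "polynomial_in UNIV (\<lambda>t. \<phi> I t $ j)" for I j
    using poly_\<phi>[of I j] by (auto simp: polynomial_in_def)
  have coord: "polynomial_in UNIV (\<lambda>x :: complex ^ 'n. x $ j)" for j
    by (simp add: polynomial_in_coord)
  have mono: "W I \<subseteq> W I'" if "I \<subseteq> I'" for I I'
  proof -
    have "\<phi> I t = \<phi> I' (ones_outside I t)" for t
    proof -
      have "ones_outside I' (ones_outside I t) = ones_outside I t"
        using that by (auto simp: ones_outside_def vec_eq_iff)
      then show ?thesis
        by (simp add: \<phi>_def)
    qed
    then have "range (\<phi> I) \<subseteq> range (\<phi> I')"
      by blast
    then show ?thesis
      unfolding W_def by (rule closure_of_mono)
  qed
  have dependent: "\<not> alg_independent_on J F (W I)"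
    if "finite J" "\<And>j. j \<in> J \<Longrightarrow> polynomial_in UNIV (F j)" "card I < card J"
    for I and J :: "'j set" and F
  proof -
    have "\<not> alg_independent_on J (\<lambda>j t. F j (\<phi> I t)) UNIV"
      by (rule not_alg_independent_if_card_less[OF that(1) _ that(3)])
        (rule polynomial_in_compose[OF that(2) poly_\<phi>])
    then show ?thesis
      unfolding W_def by (simp add: alg_independent_on_zariski_closure that(2) alg_independent_on_image)
  qed
  have strict: "W I \<noteq> W I'" if less: "card I < card I'" for I I'
  proof -
    obtain J where J: "card J = card I'"
      "\<And>u. \<forall>i\<in>I'. (\<Sum>j\<in>J. real (A $ i $ j) * u j) = 0 \<Longrightarrow> \<forall>j\<in>J. u j = 0"
      using independent_columns_of_full_row_rank[OF assms, of I']
      unfolding map_matrix_def by auto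
    have "alg_independent_on J (\<lambda>j t. \<phi> I' t $ j) UNIV"
      unfolding \<phi>_def
    proof (rule alg_independent_tensor_chebyshev)
      fix e e' :: "'n \<Rightarrow> nat"
      assume eq: "\<And>i. i \<in> I' \<Longrightarrow> (\<Sum>j\<in>J. A $ i $ j * e j) = (\<Sum>j\<in>J. A $ i $ j * e' j)"
      have "(\<Sum>j\<in>J. real (A $ i $ j) * (real (e j) - real (e' j))) = 0" if "i \<in> I'" for i
        using arg_cong[OF eq[OF that], of real]
        by (simp add: right_diff_distrib sum_subtractf)
      then have "real (e j) - real (e' j) = 0" if "j \<in> J" for j
        using J(2)[of "\<lambda>j. real (e j) - real (e' j)"] that by blast
      then show "restrict e J = restrict e' J"
        by (auto simp: restrict_def)
    qed
    then have "alg_independent_on J (\<lambda>j x. x $ j) (W I')"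
      unfolding W_def
      by (simp add: alg_independent_on_zariski_closure coord alg_independent_on_image)
    moreover have "\<not> alg_independent_on J (\<lambda>j x. x $ j) (W I)"
      by (rule dependent) (use coord J(1) less in auto)
    ultimately show ?thesis
      by metis
  qed
  have "krull_dimension X = ereal (real CARD('m))"
    unfolding krull_dimension_def
  proof (rule antisym[OF Sup_least Sup_upper])
    fix d
    assume "d \<in> {ereal (real k) | k. \<exists>Z. (\<forall>i\<le>k. closedin X (Z i) \<and> irreducible_in X (Z i)) \<and>
      (\<forall>i<k. Z i \<subset> Z (Suc i))}"
    then obtain k Z where k: "d = ereal (real k)"
      and Z: "\<And>i. i \<le> k \<Longrightarrow> closedin X (Z i)" "\<And>i. i \<le> k \<Longrightarrow> irreducible_in X (Z i)"
        "\<And>i. i < k \<Longrightarrow> Z i \<subset> Z (Suc i)"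
      by blast
    obtain F :: "nat \<Rightarrow> complex ^ 'n \<Rightarrow> complex" where
      F: "\<And>j. j < k \<Longrightarrow> polynomial_in UNIV (F j)" "alg_independent_on {..<k} F (Z k)"
      using chain_alg_independent[of k V Z] Z unfolding X_def by blast
    have "Z k \<subseteq> V"
      using Z(2)[of k] by (simp add: irreducible_in_def X_def)
    then have "alg_independent_on {..<k} F (W UNIV)"
      using F(2) alg_independent_on_mono V by blast
    then have "k \<le> CARD('m)"
      using dependent[of "{..<k}" F UNIV] F(1) by fastforce
    then show "d \<le> ereal (real CARD('m))"
      by (simp add: k)
  next
    obtain h where h: "bij_betw h {0..<CARD('m)} (UNIV :: 'm set)"
      using ex_bij_betw_nat_finite[of "UNIV :: 'm set"] by auto
    define I where "I i = h ` {..<i}" for i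
    have cardI: "card (I i) = i" if "i \<le> CARD('m)" for i
    proof -
      have "inj_on h {..<i}"
        by (rule inj_on_subset[OF bij_betw_imp_inj_on[OF h]]) (use that in auto)
      then show ?thesis
        by (simp add: I_def card_image)
    qed
    have "closedin X (W (I i)) \<and> irreducible_in X (W (I i))" for i
    proof
      have sub: "W (I i) \<subseteq> V"
        unfolding V by (rule mono) simp
      show "closedin X (W (I i))"
        unfolding X_def by (rule closedin_subset_topspace[OF _ sub]) (simp add: W_def)
      show "irreducible_in X (W (I i))"
        using sub unfolding X_def W_def
        by (rule irreducible_in_closure_of_polynomial_image[OF poly_\<phi>_UNIV])
    qed
    moreover have "W (I i) \<subset> W (I (Suc i))" if "i < CARD('m)" for i
      using mono[of "I i" "I (Suc i)"] strict[of "I i" "I (Suc i)"] cardI[of i] cardI[of "Suc i"] that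
      by (auto simp: I_def lessThan_Suc)
    ultimately show "ereal (real CARD('m)) \<in> {ereal (real k) | k. \<exists>Z.
      (\<forall>i\<le>k. closedin X (Z i) \<and> irreducible_in X (Z i)) \<and> (\<forall>i<k. Z i \<subset> Z (Suc i))}"
      by (intro CollectI exI[of _ "CARD('m)"] conjI exI[of _ "\<lambda>i. W (I i)"]) auto
  qed
  then show ?thesis
    by (simp add: zariski_dimension_def X_def V_def)
qed

end
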